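(* For every multi-objective combinatorial optimization (MOCO) problem with non-empty set of non-dominated points, the set $\mathcal{Y}_S$ of supported non-dominated points and the set $\mathcal{Y}_{wS}$ of weakly supported non-dominated points satisfy $\mathcal{Y}_S\subseteq\mathcal{Y}_{wS}$. Moreover, there exist MOCO instances for which the inclusion is strict, i.e. $\mathcal{Y}_S\subsetneq\mathcal{Y}_{wS}$.
   Context: A MOCO problem is given by $p\ge 2$, $A\in\mathbb{Z}^{m\times n}$, $b\in\mathbb{Z}^m$, $C\in\mathbb{Z}^{p\times n}$ and is the problem $\min_{x\in\mathcal{X}} Cx$ with $\mathcal{X}=\{x\in\{0,1\}^n : Ax=b\}$ and outcome set $\mathcal{Y}=\{Cx : x\in\mathcal{X}\}$. For $y^1,y^2\in\mathbb{R}^p$: $y^1\leqq y^2$ means $y^1_i\le y^2_i$ for all $i$; $y^1\le y^2$ means $y^1\leqq y^2$ and $y^1\neq y^2$; $y^1<y^2$ means $y^1_i<y^2_i$ for all $i$. Let $\mathbb{R}^p_{\geq}=\{y\in\mathbb{R}^p : y\geqq 0,\ y\neq 0\}$ and $\mathbb{R}^p_{>}=\{y\in\mathbb{R}^p : y>0\}$. A feasible solution $x^*\in\mathcal{X}$ is efficient if there is no $x\in\mathcal{X}$ with $Cx\le Cx^*$ (that is, $Cx\leqq Cx^*$ and $Cx\ne Cx^*$); its image $Cx^*$ is then called non-dominated. Let $\Lambda_p=\{\lambda\in\mathbb{R}^p_{>} : \sum_{i=1}^p\lambda_i=1\}$ and $\Lambda_p^0=\{\lambda\in\mathbb{R}^p_{\geq}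 : \sum_{i=1}^p\lambda_i=1\}$, and let $P_\lambda$ denote the weighted-sum problem $\min_{x\in\mathcal{X}}\lambda^\top Cx$. An efficient solution is weakly supported if it is an optimal solution of $P_\lambda$ for some $\lambda\in\Lambda_p^0$, and supported if it is an optimal solution of $P_\lambda$ for some $\lambda\in\Lambda_p$. $\mathcal{Y}_{wS}$ and $\mathcal{Y}_S$ are the sets of images of weakly supported and supported efficient solutions, respectively. *)

theory Defs
  imports Complex_Main "Jordan_Normal_Form.Matrix"
begin

text \<open>
  Problem data are integer matrices and vectors with explicit dimensions, since the dimensions
  are quantified over.  On vectors, the library relation \<open>\<le>\<close> is the componentwise
  weak order; the vector relation \<open><\<close> is never used, because in the library it is the strict
  part of \<open>\<le>\<close> and not the componentwise strict order.
\<close>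

definition is_moco ::
  "nat \<Rightarrow> nat \<Rightarrow> nat \<Rightarrow> int mat \<Rightarrow> int vec \<Rightarrow> int mat \<Rightarrow> bool" where
  "is_moco p m n A b C \<longleftrightarrow>
     2 \<le> p \<and> A \<in> carrier_mat m n \<and> b \<in> carrier_vec m \<and> C \<in> carrier_mat p n"

definition feasible_set :: "int mat \<Rightarrow> int vec \<Rightarrow> int vec set" where
  "feasible_set A b =
     {x \<in> carrier_vec (dim_col A). (\<forall>j<dim_col A. x $ j \<in> {0, 1}) \<and> A *\<^sub>v x = b}"

text \<open>The integer vector \<open>C x\<close>, viewed as a point of the real outcome space.\<close>

definition outcome :: "int mat \<Rightarrow> int vec \<Rightarrow> real vec" where
  "outcome C x = map_vec real_of_int (C *\<^sub>v x)"

definition efficient :: "int mat \<Rightarrow> int vec \<Rightarrow> int mat \<Rightarrow> int vec \<Rightarrow> bool" where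
  "efficient A b C x \<longleftrightarrow> x \<in> feasible_set A b \<and>
     \<not> (\<exists>x' \<in> feasible_set A b. outcome C x' \<le> outcome C x \<and> outcome C x' \<noteq> outcome C x)"

definition nondominated_set :: "int mat \<Rightarrow> int vec \<Rightarrow> int mat \<Rightarrow> real vec set" where
  "nondominated_set A b C = outcome C ` {x. efficient A b C x}"

definition positive_weights :: "nat \<Rightarrow> real vec set" where
  "positive_weights p =
     {w \<in> carrier_vec p. (\<forall>i<p. 0 < w $ i) \<and> (\<Sum>i<p. w $ i) = 1}"

definition nonnegative_weights :: "nat \<Rightarrow> real vec set" where
  "nonnegative_weights p =
     {w \<in> carrier_vec p. 0\<^sub>v p \<le> w \<and> w \<noteq> 0\<^sub>v p \<and> (\<Sum>i<p. w $ i) = 1}"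

definition weighted_sum_optimal ::
  "int mat \<Rightarrow> int vec \<Rightarrow> int mat \<Rightarrow> real vec \<Rightarrow> int vec \<Rightarrow> bool" where
  "weighted_sum_optimal A b C w x \<longleftrightarrow> x \<in> feasible_set A b \<and>
     (\<forall>x' \<in> feasible_set A b. w \<bullet> outcome C x \<le> w \<bullet> outcome C x')"

definition weakly_supported :: "int mat \<Rightarrow> int vec \<Rightarrow> int mat \<Rightarrow> int vec \<Rightarrow> bool" where
  "weakly_supported A b C x \<longleftrightarrow> efficient A b C x \<and>
     (\<exists>w \<in> nonnegative_weights (dim_row C). weighted_sum_optimal A b C w x)"

definition supported :: "int mat \<Rightarrow> int vec \<Rightarrow> int mat \<Rightarrow> int vec \<Rightarrow> bool" where
  "supported A b C x \<longleftrightarrow> efficient A b C x \<and>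
     (\<exists>w \<in> positive_weights (dim_row C). weighted_sum_optimal A b C w x)"

definition weakly_supported_nondominated_set ::
  "int mat \<Rightarrow> int vec \<Rightarrow> int mat \<Rightarrow> real vec set" where
  "weakly_supported_nondominated_set A b C = outcome C ` {x. weakly_supported A b C x}"

definition supported_nondominated_set ::
  "int mat \<Rightarrow> int vec \<Rightarrow> int mat \<Rightarrow> real vec set" where
  "supported_nondominated_set A b C = outcome C ` {x. supported A b C x}"

end

theory Submission
  imports Defs
begin

text \<open>
  Positive weights are in particular nonnegative and nonzero, which gives the inclusion.  For
  strictness, a third objective that is identically zero makes every efficient solution weakly
  supported by the weight \<open>(0, 0, 1)\<close>.  Let the outcomes be \<open>(0, 3, 0)\<close>,
  \<open>(2, 2, 0)\<close> and \<open>(3, 0, 0)\<close>.  They are pairwise incomparable, but the middle one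
  lies strictly above the midpoint of the other two in the first two coordinates, so no positive
  weight supports it.  Two objectives would not suffice, since then every weakly supported
  efficient solution is supported.
\<close>

lemma positive_weights_subset_nonnegative_weights:
  assumes "0 < p"
  shows "positive_weights p \<subseteq> nonnegative_weights p"
proof
  fix w assume w: "w \<in> positive_weights p"
  then have "w \<noteq> 0\<^sub>v p"
    using assms by (auto simp: positive_weights_def)
  with w show "w \<in> nonnegative_weights p"
    by (auto simp: positive_weights_def nonnegative_weights_def less_eq_vec_def less_imp_le)
qed

lemma supported_nondominated_set_subset:
  assumes "0 < dim_row C"
  shows "supported_nondominated_set A b C \<subseteq> weakly_supported_nondominated_set A b C"
  using positive_weights_subset_nonnegative_weights[OF assms]
  by (auto simp: supported_nondominated_set_def weakly_supported_nondominated_set_def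
      supported_def weakly_supported_def)

text \<open>With \<open>choice_rhs\<close> this is the single constraint x0 + x1 + x2 = 1: exactly
  one of three items is chosen, so the feasible points are the three unit vectors.\<close>

definition choice_mat :: "int mat" where
  "choice_mat = mat 1 3 (\<lambda>_. 1)"

definition choice_rhs :: "int vec" where
  "choice_rhs = vec 1 (\<lambda>_. 1)"

text \<open>A unit vector selects a column, so the intended outcomes are the columns of this matrix,
  while its rows are the objectives.\<close>

definition flat_cost :: "int mat" where
  "flat_cost = mat_of_rows_list 3 [[0, 2, 3], [3, 2, 0], [0, 0, 0]]"

definition middle :: "real vec" where
  "middle = vec_of_list [2, 2, 0]"

lemma sum_lessThan_3: "(\<Sum>i<3. f i) = f 0 + f 1 + f (2::nat)"
  for f :: "nat \<Rightarrow> 'a::comm_monoid_add"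
  by (simp add: numeral_3_eq_3 numeral_2_eq_2)

lemma all_less_3: "(\<forall>i<3. P i) \<longleftrightarrow> P 0 \<and> P 1 \<and> P (2::nat)"
  by (auto simp: numeral_3_eq_3 numeral_2_eq_2 less_Suc_eq)

lemma feasible_choice_iff:
  "x \<in> feasible_set choice_mat choice_rhs \<longleftrightarrow>
     dim_vec x = 3 \<and> x $ 0 \<in> {0, 1} \<and> x $ 1 \<in> {0, 1} \<and> x $ 2 \<in> {0, 1} \<and>
     x $ 0 + x $ 1 + x $ 2 = 1"
proof -
  have "choice_mat *\<^sub>v x = choice_rhs \<longleftrightarrow> x $ 0 + x $ 1 + x $ 2 = 1" if "dim_vec x = 3"
    using that
    by (simp add: choice_mat_def choice_rhs_def vec_eq_iff scalar_prod_def
        atLeast0LessThan sum_lessThan_3)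
  moreover have "dim_col choice_mat = 3"
    by (simp add: choice_mat_def)
  ultimately show ?thesis
    by (simp only: feasible_set_def carrier_vec_def mem_Collect_eq all_less_3) blast
qed

lemma outcome_flat_cost:
  assumes "dim_vec x = 3"
  shows "outcome flat_cost x =
    vec_of_list [of_int (2 * x $ 1 + 3 * x $ 2), of_int (3 * x $ 0 + 2 * x $ 1), 0]"
  using assms
  by (simp add: outcome_def flat_cost_def mat_of_rows_list_def vec_eq_iff All_less_Suc
      scalar_prod_def atLeast0LessThan sum_lessThan_3 numeral_2_eq_2)

text \<open>Of three binary entries with sum 1, exactly one equals 1. The arguments about
  \<open>middle\<close> below work with this image set and never return to the entries of feasible
  points.\<close>

lemma outcomes_of_choice:
  "outcome flat_cost ` feasible_set choice_mat choice_rhs =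
     {vec_of_list [0, 3, 0], middle, vec_of_list [3, 0, 0]}"
proof (intro equalityI subsetI)
  fix y assume "y \<in> outcome flat_cost ` feasible_set choice_mat choice_rhs"
  then show "y \<in> {vec_of_list [0, 3, 0], middle, vec_of_list [3, 0, 0]}"
    by (auto simp: feasible_choice_iff outcome_flat_cost middle_def)
next
  \<comment> \<open>For the converse inclusion, the feasible point with entries a, c, d attains this
    outcome; the three unit vectors are substituted at the end.\<close>
  have unit: "vec_of_list [of_int (2 * c + 3 * d), of_int (3 * a + 2 * c), 0]
      \<in> outcome flat_cost ` feasible_set choice_mat choice_rhs"
    if "a \<in> {0, 1}" "c \<in> {0, 1}" "d \<in> {0, 1}" "a + c + d = 1" for a c d :: int
    using that
    by (intro image_eqI[where x = "vec_of_list [a, c, d]"])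
      (simp_all add: feasible_choice_iff outcome_flat_cost numeral_2_eq_2)
  fix y assume "y \<in> {vec_of_list [0, 3, 0], middle, vec_of_list [3, 0, 0 :: real]}"
  then show "y \<in> outcome flat_cost ` feasible_set choice_mat choice_rhs"
    using unit[of 1 0 0] unit[of 0 1 0] unit[of 0 0 1] by (auto simp: middle_def)
qed

lemma dim_row_flat_cost: "dim_row flat_cost = 3"
  by (simp add: flat_cost_def mat_of_rows_list_def)

lemma scalar_prod_vec_of_list_3:
  "w \<bullet> vec_of_list [a, b, c] = w $ 0 * a + w $ 1 * b + w $ 2 * c"
  for a b c :: "'a::comm_semiring_1"
  by (simp add: scalar_prod_def numeral_3_eq_3 numeral_2_eq_2)

lemma middle_weakly_supported:
  "middle \<in> weakly_supported_nondominated_set choice_mat choice_rhs flat_cost"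
proof -
  have "middle \<in> outcome flat_cost ` feasible_set choice_mat choice_rhs"
    by (simp add: outcomes_of_choice)
  then obtain x where x: "x \<in> feasible_set choice_mat choice_rhs" "outcome flat_cost x = middle"
    by (metis imageE)
  have outcomes: "outcome flat_cost x' \<in> {vec_of_list [0, 3, 0], middle, vec_of_list [3, 0, 0]}"
    if "x' \<in> feasible_set choice_mat choice_rhs" for x'
    using imageI[OF that, of "outcome flat_cost"] by (simp only: outcomes_of_choice)
  \<comment> \<open>Each of the two other outcomes has a coordinate 3 where \<open>middle\<close>
    has 2, so neither can dominate it.\<close>
  have "\<not> vec_of_list [0, 3, 0] \<le> middle" "\<not> vec_of_list [3, 0, 0] \<le> middle"
    by (auto simp: middle_def less_eq_vec_def numeral_3_eq_3 numeral_2_eq_2 less_Suc_eq)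
  then have "outcome flat_cost x' = middle"
    if "x' \<in> feasible_set choice_mat choice_rhs" "outcome flat_cost x' \<le> middle" for x'
    using outcomes[OF that(1)] that(2) by auto
  with x have efficient: "efficient choice_mat choice_rhs flat_cost x"
    by (simp add: efficient_def)
  let ?w = "vec_of_list [0, 0, 1 :: real]"
  have w: "dim_vec ?w = 3" "?w $ 0 = 0" "?w $ 1 = 0" "?w $ 2 = 1"
    by (simp_all add: numeral_2_eq_2)
  have "?w \<in> carrier_vec 3"
    using w(1) by (rule carrier_vecI)
  moreover have "0\<^sub>v 3 \<le> ?w"
    unfolding less_eq_vec_def w(1) all_less_3 w(2-4) by simp
  moreover have "?w \<noteq> 0\<^sub>v 3"
  proof
    assume "?w = 0\<^sub>v 3"
    then have "?w $ 2 = 0\<^sub>v 3 $ 2"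
      by (rule arg_cong)
    then show False
      unfolding w(4) by simp
  qed
  moreover have "(\<Sum>i<3. ?w $ i) = 1"
    unfolding sum_lessThan_3 w(2-4) by simp
  ultimately have "?w \<in> nonnegative_weights 3"
    unfolding nonnegative_weights_def by blast
  moreover have "weighted_sum_optimal choice_mat choice_rhs flat_cost ?w x"
  proof -
    \<comment> \<open>This weight reads off only the third coordinate, which is 0 for all outcomes,
      so all feasible points tie as optimal.\<close>
    have "?w \<bullet> outcome flat_cost x' = 0" if "x' \<in> feasible_set choice_mat choice_rhs" for x'
      using outcomes[OF that]
      by (elim insertE emptyE) (simp_all only: middle_def scalar_prod_vec_of_list_3, simp_all)
    with x(1) show ?thesis
      by (simp add: weighted_sum_optimal_def)
  qed
  ultimately show ?thesis
    using x(2) efficient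
    unfolding weakly_supported_nondominated_set_def weakly_supported_def dim_row_flat_cost
    by (intro image_eqI[where x = x] CollectI conjI bexI[where x = ?w]) simp_all
qed

lemma middle_not_supported:
  "middle \<notin> supported_nondominated_set choice_mat choice_rhs flat_cost"
proof
  assume "middle \<in> supported_nondominated_set choice_mat choice_rhs flat_cost"
  then obtain x where x: "outcome flat_cost x = middle"
    and "supported choice_mat choice_rhs flat_cost x"
    unfolding supported_nondominated_set_def by (metis imageE mem_Collect_eq)
  then obtain w where w: "w \<in> positive_weights 3"
    and opt: "weighted_sum_optimal choice_mat choice_rhs flat_cost w x"
    unfolding supported_def dim_row_flat_cost by blast
  have "\<forall>y \<in> outcome flat_cost ` feasible_set choice_mat choice_rhs. w \<bullet> middle \<le> w \<bullet> y"
    using opt x by (simp add: weighted_sum_optimal_def)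
  \<comment> \<open>Optimality is tested against (0, 3, 0) and (3, 0, 0). Adding the two
    inequalities gives w0 + w1 \<le> 0, which positive weights forbid but (0, 0, 1)
    satisfies.\<close>
  then have "2 * w $ 0 + 2 * w $ 1 \<le> 3 * w $ 1" "2 * w $ 0 + 2 * w $ 1 \<le> 3 * w $ 0"
    unfolding outcomes_of_choice middle_def ball_simps scalar_prod_vec_of_list_3
    by (simp_all add: algebra_simps)
  moreover have "0 < w $ 0" "0 < w $ 1"
    using w by (auto simp: positive_weights_def)
  ultimately show False
    by linarith
qed

theorem theorem2p7:
  shows "(\<forall>p m n A b C. is_moco p m n A b C \<and> nondominated_set A b C \<noteq> {} \<longrightarrow>
            supported_nondominated_set A b C \<subseteq> weakly_supported_nondominated_set A b C) \<and>
         (\<exists>p m n A b C. 0 < m \<and> 0 < n \<and> is_moco p m n A b C \<and> nondominated_set A b C \<noteq> {} \<and>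
            supported_nondominated_set A b C \<subset> weakly_supported_nondominated_set A b C)"
proof (intro conjI allI impI)
  fix p m n :: nat and A b C
  assume "is_moco p m n A b C \<and> nondominated_set A b C \<noteq> {}"
  then show "supported_nondominated_set A b C \<subseteq> weakly_supported_nondominated_set A b C"
    by (intro supported_nondominated_set_subset) (auto simp: is_moco_def)
next
  let ?A = choice_mat and ?b = choice_rhs and ?C = flat_cost
  have "is_moco 3 1 3 ?A ?b ?C"
    unfolding is_moco_def
    by (intro conjI carrier_matI carrier_vecI)
      (simp_all add: choice_mat_def choice_rhs_def flat_cost_def mat_of_rows_list_def)
  \<comment> \<open>Weak support includes efficiency by definition, so \<open>middle\<close> also
    witnesses that the non-dominated set is non-empty.\<close>
  moreover have "weakly_supported_nondominated_set ?A ?b ?C \<subseteq> nondominated_set ?A ?b ?C"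
    unfolding weakly_supported_nondominated_set_def nondominated_set_def weakly_supported_def
    by (intro image_mono Collect_mono impI) (rule conjunct1)
  then have "nondominated_set ?A ?b ?C \<noteq> {}"
    using middle_weakly_supported by blast
  moreover have "supported_nondominated_set ?A ?b ?C \<subset> weakly_supported_nondominated_set ?A ?b ?C"
  proof (rule psubsetI)
    show "supported_nondominated_set ?A ?b ?C \<subseteq> weakly_supported_nondominated_set ?A ?b ?C"
      by (rule supported_nondominated_set_subset) (simp add: dim_row_flat_cost)
    show "supported_nondominated_set ?A ?b ?C \<noteq> weakly_supported_nondominated_set ?A ?b ?C"
      using middle_weakly_supported middle_not_supported by metis
  qed
  ultimately have "0 < (1::nat) \<and> 0 < (3::nat) \<and> is_moco 3 1 3 ?A ?b ?C \<and>
      nondominated_set ?A ?b ?C \<noteq> {} \<and>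
      supported_nondominated_set ?A ?b ?C \<subset> weakly_supported_nondominated_set ?A ?b ?C"
    by (intro conjI; (assumption | simp))
  then show "\<exists>p m n A b C. 0 < m \<and> 0 < n \<and> is_moco p m n A b C \<and>
      nondominated_set A b C \<noteq> {} \<and>
      supported_nondominated_set A b C \<subset> weakly_supported_nondominated_set A b C"
    by (intro exI)
qed

end
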